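(* Let $\mathbb{K}$ be a field, let $n \ge 1$, let $\Omega = (\omega_{ij})$ be an $n \times n$ skew-symmetric matrix with entries in $\mathbb{K}$, and let $\mathcal{R}_\Omega = \mathbb{K}(x_1,\dots,x_n)$ be the field of rational functions equipped with the Poisson bracket determined by $\{x_i,x_j\} = \omega_{ij}x_ix_j$. If $f_1,\dots,f_n \in \mathcal{R}_\Omega$ are rational functions such that $$\{f_i,f_j\} = \sum_{k=1}^n c^k_{ij} f_k + d_{ij}$$ with $c^k_{ij}, d_{ij} \in \mathbb{K}$ for $1 \le i,j,k \le n$, then $\{f_i,f_j\} = 0$ for all $1 \le i,j \le n$.
   Context: A Poisson bracket on an associative $\mathbb{K}$-algebra $P$ is a skew-symmetric $\mathbb{K}$-bilinear map $\{\cdot,\cdot\}: P\times P\to P$ satisfying the Leibniz identity $\{ab,c\} = a\{b,c\}+\{a,c\}b$ and the Jacobi identity $\{a,\{b,c\}\}+\{b,\{c,a\}\}+\{c,\{a,b\}\}=0$. Skew-symmetric means $\{a,b\}=-\{b,a\}$ and $\{a,a\}=0$; for the matrix, $\omega_{ij}=-\omega_{ji}$ and $\omega_{ii}=0$. The bracket on $\mathcal{R}_\Omega$ is given explicitly by $\{f,g\} = \sum_{i,j=1}^n \frac{\partial f}{\partial x_i}\frac{\partial g}{\partial x_j}\,\omega_{ij}x_ix_j$. *)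

theory Defs
  imports
    "HOL-Library.Poly_Mapping"
    "HOL-Computational_Algebra.Fraction_Field"
    "HOL-Analysis.Finite_Cartesian_Product"
begin

text \<open>
  The variables are indexed by a finite type \<open>'n\<close>, so \<open>n\<close> is \<open>CARD('n)\<close>, which is at least 1.
  The linear order on \<open>'n\<close> has no mathematical content: it is what the instance making
  \<open>('n \<Rightarrow>\<^sub>0 nat) \<Rightarrow>\<^sub>0 'k\<close> an integral domain asks for, and hence what
  \<^typ>\<open>'a fract\<close> needs to be available.
\<close>

type_synonym ('n, 'k) mpoly = "('n \<Rightarrow>\<^sub>0 nat) \<Rightarrow>\<^sub>0 'k"

type_synonym ('n, 'k) ratfun = "('n, 'k) mpoly fract"

definition rf_const :: "'k::field \<Rightarrow> ('n::{finite,linorder}, 'k) ratfun" where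
  "rf_const c = Fraction_Field.Fract (Poly_Mapping.single 0 c) 1"

definition rf_var :: "'n::{finite,linorder} \<Rightarrow> ('n, 'k::field) ratfun" where
  "rf_var i = Fraction_Field.Fract (Poly_Mapping.single (Poly_Mapping.single i 1) 1) 1"

lift_definition mpoly_deriv :: "'n \<Rightarrow> ('n, 'k) mpoly \<Rightarrow> ('n, 'k::comm_ring_1) mpoly"
  is "\<lambda>i p m. of_nat (Poly_Mapping.lookup m i + 1) * p (m + Poly_Mapping.single i 1)"
proof -
  fix i :: 'n and p :: "('n \<Rightarrow>\<^sub>0 nat) \<Rightarrow> 'k"
  assume "finite {m. p m \<noteq> 0}"
  then have "finite ((\<lambda>m. m + Poly_Mapping.single i 1) -` {m. p m \<noteq> 0})"
    by (intro finite_vimageI) (auto intro: injI)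
  then show "finite {m. of_nat (Poly_Mapping.lookup m i + 1)
      * p (m + Poly_Mapping.single i 1) \<noteq> 0}"
    by (rule rev_finite_subset) auto
qed

lemma mpoly_deriv_add: "mpoly_deriv i (p + q) = mpoly_deriv i p + mpoly_deriv i q"
  by (rule poly_mapping_eqI)
    (simp add: mpoly_deriv.rep_eq lookup_add algebra_simps)

lemma mpoly_deriv_0 [simp]: "mpoly_deriv i 0 = 0"
  by (rule poly_mapping_eqI) (simp add: mpoly_deriv.rep_eq)

lemma mpoly_deriv_single:
  "mpoly_deriv i (Poly_Mapping.single m a) =
    Poly_Mapping.single (m - Poly_Mapping.single i 1) (of_nat (Poly_Mapping.lookup m i) * a)"
proof (rule poly_mapping_eqI)
  fix k
  have "m = k + Poly_Mapping.single i 1 \<longleftrightarrow>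
      Poly_Mapping.lookup m i \<noteq> 0 \<and> m - Poly_Mapping.single i 1 = k"
  proof
    assume "Poly_Mapping.lookup m i \<noteq> 0 \<and> m - Poly_Mapping.single i 1 = k"
    then show "m = k + Poly_Mapping.single i 1"
      by (intro poly_mapping_eqI)
        (auto simp: lookup_add lookup_minus lookup_single when_def)
  qed (simp add: lookup_add)
  then show "Poly_Mapping.lookup (mpoly_deriv i (Poly_Mapping.single m a)) k =
    Poly_Mapping.lookup (Poly_Mapping.single (m - Poly_Mapping.single i 1)
      (of_nat (Poly_Mapping.lookup m i) * a)) k"
    by (cases "Poly_Mapping.lookup m i = 0")
      (auto simp: mpoly_deriv.rep_eq lookup_single when_def lookup_add lookup_minus)
qed

lemma mpoly_deriv_mult_single:
  "mpoly_deriv i (Poly_Mapping.single m a * Poly_Mapping.single l b) =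
    mpoly_deriv i (Poly_Mapping.single m a) * Poly_Mapping.single l b +
    Poly_Mapping.single m a * mpoly_deriv i (Poly_Mapping.single l b)"
proof -
  define e where "e = Poly_Mapping.single i (1::nat)"
  have shift: "m - e + l = m + l - e" if "Poly_Mapping.lookup m i \<noteq> 0" for m l :: "'a \<Rightarrow>\<^sub>0 nat"
    unfolding e_def using that
    by (intro poly_mapping_eqI) (auto simp: lookup_add lookup_minus lookup_single when_def)
  have "Poly_Mapping.single (m - e) (of_nat (Poly_Mapping.lookup m i) * a) * Poly_Mapping.single l b =
      Poly_Mapping.single (m + l - e) (of_nat (Poly_Mapping.lookup m i) * (a * b))"
    by (cases "Poly_Mapping.lookup m i = 0") (simp_all add: mult_single shift mult.assoc)
  moreover have "Poly_Mapping.single m a * Poly_Mapping.single (l - e) (of_nat (Poly_Mapping.lookup l i) * b) =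
      Poly_Mapping.single (m + l - e) (of_nat (Poly_Mapping.lookup l i) * (a * b))"
    using shift [of l m]
    by (cases "Poly_Mapping.lookup l i = 0") (simp_all add: mult_single ac_simps)
  ultimately show ?thesis
    unfolding mpoly_deriv_single mult_single e_def [symmetric]
    by (simp add: lookup_add distrib_right single_add)
qed

lemma mpoly_single_add_induct:
  assumes "P 0" and "\<And>m a p. P p \<Longrightarrow> P (Poly_Mapping.single m a + p)"
  shows "P (p :: ('n, 'k::comm_ring_1) mpoly)"
proof (induction p rule: update_induct)
  case const
  show ?case by (fact assms(1))
next
  case (update p m a)
  have "Poly_Mapping.update m a p = Poly_Mapping.single m a + p"
    using update.hyps
    by (intro poly_mapping_eqI) (auto simp: lookup_update lookup_add lookup_single when_def
        in_keys_iff)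
  with update assms(2) show ?case by simp
qed

lemma mpoly_deriv_mult: "mpoly_deriv i (p * q) = mpoly_deriv i p * q + p * mpoly_deriv i q"
proof (induction p rule: mpoly_single_add_induct)
  case 1
  show ?case by simp
next
  case (2 m a p)
  have "mpoly_deriv i (Poly_Mapping.single m a * q) =
      mpoly_deriv i (Poly_Mapping.single m a) * q + Poly_Mapping.single m a * mpoly_deriv i q"
    by (induction q rule: mpoly_single_add_induct)
      (simp_all add: mpoly_deriv_add mpoly_deriv_mult_single distrib_left)
  with 2 show ?case
    by (simp add: mpoly_deriv_add distrib_right)
qed

lemma quotient_rule_respects:
  fixes a b c d a' b' c' d' :: "'a::idom"
  assumes eq: "a * d = c * b" and deriv: "a' * d + a * d' = c' * b + c * b'"
  shows "(a' * b - a * b') * (d * d) = (c' * d - c * d') * (b * b)"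
proof -
  have "(a' * b - a * b') * (d * d) - (c' * d - c * d') * (b * b) =
      (a' * d + a * d' - (c' * b + c * b')) * (b * d) - (a * d - c * b) * (b' * d + b * d')"
    by (simp add: algebra_simps)
  then show ?thesis using assms by simp
qed

lift_definition rf_deriv ::
    "'n::{finite,linorder} \<Rightarrow> ('n, 'k::field) ratfun \<Rightarrow> ('n, 'k) ratfun"
  is "\<lambda>i q. (mpoly_deriv i (fst q) * snd q - fst q * mpoly_deriv i (snd q), snd q * snd q)"
proof -
  fix i :: 'n and q r :: "('n, 'k) mpoly \<times> ('n, 'k) mpoly"
  assume "fractrel q r"
  then have nz: "snd q \<noteq> 0" "snd r \<noteq> 0" and eq: "fst q * snd r = fst r * snd q"
    by auto
  from eq have "mpoly_deriv i (fst q * snd r) = mpoly_deriv i (fst r * snd q)" by simp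
  then show "fractrel
      (mpoly_deriv i (fst q) * snd q - fst q * mpoly_deriv i (snd q), snd q * snd q)
      (mpoly_deriv i (fst r) * snd r - fst r * mpoly_deriv i (snd r), snd r * snd r)"
    using nz quotient_rule_respects [OF eq] by (simp add: mpoly_deriv_mult)
qed

lemma rf_deriv_Fract:
  assumes "b \<noteq> 0"
  shows "rf_deriv i (Fraction_Field.Fract a b) =
    Fraction_Field.Fract (mpoly_deriv i a * b - a * mpoly_deriv i b) (b * b)"
  using assms by (simp add: Fraction_Field.Fract.abs_eq rf_deriv.abs_eq)

lemma rf_deriv_var: "rf_deriv i (rf_var j) = (if i = j then 1 else 0)"
proof -
  have one: "mpoly_deriv i 1 = (0 :: ('a, 'b) mpoly)"
    using mpoly_deriv_single [of i 0 "1::'b"] by simp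
  show ?thesis
    by (simp add: rf_var_def rf_deriv_Fract one mpoly_deriv_single lookup_single when_def
        One_fract_def Zero_fract_def)
qed

text \<open>The diagonal condition is not redundant in characteristic 2.\<close>

definition skew_symmetric :: "'k::ring_1 ^ 'n ^ 'n \<Rightarrow> bool" where
  "skew_symmetric A \<longleftrightarrow> (\<forall>i j. A $ i $ j = - A $ j $ i) \<and> (\<forall>i. A $ i $ i = 0)"

definition rf_bracket :: "'k::field ^ 'n::{finite,linorder} ^ 'n::{finite,linorder} \<Rightarrow> ('n, 'k) ratfun \<Rightarrow>
    ('n, 'k) ratfun \<Rightarrow> ('n, 'k) ratfun" where
  "rf_bracket \<Omega> f g = (\<Sum>i\<in>UNIV. \<Sum>j\<in>UNIV.
     rf_deriv i f * rf_deriv j g * (rf_const (\<Omega> $ i $ j) * rf_var i * rf_var j))"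

lemma rf_bracket_var:
  "rf_bracket \<Omega> (rf_var i) (rf_var j) = rf_const (\<Omega> $ i $ j) * rf_var i * rf_var j"
proof -
  have t: "rf_deriv k (rf_var i) * rf_deriv l (rf_var j) * u =
      (if l = j then if k = i then u else 0 else 0)" for k l and u :: "('a, 'b) ratfun"
    by (simp add: rf_deriv_var)
  show ?thesis
    unfolding rf_bracket_def t by simp
qed

end

theory Submission
  imports Defs "HOL-Algebra.Algebraic_Closure_Type" "HOL-Computational_Algebra.Formal_Laurent_Series"
begin

text \<open>
  Fix \<open>i\<close> and let \<open>D = {f\<^sub>i, -}\<close>, a derivation. The hypothesis says that the span \<open>V\<close> of
  \<open>1, f\<^sub>1, \<dots>, f\<^sub>n\<close> is a finite-dimensional \<open>D\<close>-stable space of rational functions, and the claim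
  is that \<open>D\<close> vanishes on it. Everything rests on one obstruction: a bracket \<open>{f, g}\<close> of rational
  functions is never a nonzero constant (\<open>rf_bracket_eq_const_imp_0\<close>).

  The obstruction comes from a residue. In terms of the commuting Euler derivations
  \<open>E\<^sub>i = x\<^sub>i \<partial>/\<partial>x\<^sub>i\<close> the bracket has constant coefficients, \<open>{f, g} = \<Sum> \<omega>\<^sub>i\<^sub>j E\<^sub>i f E\<^sub>j g\<close>, so by skew
  symmetry it is a divergence \<open>\<Sum>\<^sub>j E\<^sub>j h\<^sub>j\<close>. Expanding a rational function as a Laurent series
  in one variable after the other and keeping the constant term each time gives an additive map
  (\<open>full_const_term\<close>) that kills every \<open>E\<^sub>j h\<close> and fixes the constants. Applied to \<open>{f, g} = c\<close> it yields \<open>c = 0\<close>.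

  Two consequences use that the rational functions form a field. If \<open>D g = c g\<close> with \<open>g \<noteq> 0\<close>,
  then \<open>{f / g, g} = c\<close> because \<open>{g, g} = 0\<close>, and so \<open>c = 0\<close>: the only eigenvalue of \<open>D\<close> is \<open>0\<close>.
  If \<open>D\<^sup>2 g = 0\<close> but \<open>h = D g \<noteq> 0\<close>, then \<open>D (g / h) = 1\<close>, which is impossible: \<open>D\<close> has no
  nontrivial Jordan block. Over an algebraically closed field a linear operator that satisfies a
  polynomial equation, has no eigenvalue except \<open>0\<close> and no nontrivial Jordan block is zero, so
  \<open>D\<close> vanishes on \<open>V\<close> (\<open>rf_bracket_locally_finite\<close>). The general case follows by extending scalars to the algebraic closure.
\<close>

no_notation fps_nth (infixl \<open>$\<close> 75)

section \<open>Derivations and fields of fractions\<close>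

locale derivation =
  fixes D :: "'a::comm_ring_1 \<Rightarrow> 'a"
  assumes add: "D (a + b) = D a + D b"
    and mult: "D (a * b) = D a * b + a * D b"
begin

lemma zero [simp]: "D 0 = 0"
  using add [of 0 0] by simp

lemma diff: "D (a - b) = D a - D b"
  using add [of "a - b" b] by simp

lemma sum: "D (\<Sum>x\<in>A. g x) = (\<Sum>x\<in>A. D (g x))"
  by (induction A rule: infinite_finite_induct) (simp_all add: add)

end

text \<open>
  An injective homomorphism into a field extends to the field of fractions. This extension is
  applied twice below: to the Laurent expansion along a variable and to the extension of scalars.
\<close>

locale embedding =
  fixes \<theta> :: "'r::idom \<Rightarrow> 'f::field"
  assumes add: "\<theta> (a + b) = \<theta> a + \<theta> b"
    and mult: "\<theta> (a * b) = \<theta> a * \<theta> b"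
    and one: "\<theta> 1 = 1"
    and eq_0: "\<theta> a = 0 \<Longrightarrow> a = 0"
begin

definition lift :: "'r fract \<Rightarrow> 'f" where
  "lift h = (SOME y. \<exists>a b. b \<noteq> 0 \<and> h = Fraction_Field.Fract a b \<and> y = \<theta> a / \<theta> b)"

lemma zero [simp]: "\<theta> 0 = 0"
  using add [of 0 0] by (metis add_cancel_right_right add_0)

lemma lift_Fract:
  assumes "b \<noteq> 0"
  shows "lift (Fraction_Field.Fract a b) = \<theta> a / \<theta> b"
proof -
  have "\<theta> a' / \<theta> b' = \<theta> a / \<theta> b"
    if "b' \<noteq> 0" "Fraction_Field.Fract a b = Fraction_Field.Fract a' b'" for a' b'
  proof -
    have "\<theta> a * \<theta> b' = \<theta> a' * \<theta> b"
      using that assms by (metis eq_fract(1) mult)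
    moreover have "\<theta> b \<noteq> 0" "\<theta> b' \<noteq> 0"
      using that assms eq_0 by blast+
    ultimately show ?thesis by (simp add: field_simps)
  qed
  then show ?thesis
    unfolding lift_def using assms by (intro some_equality) blast+
qed

lemma lift_Fract_1: "lift (Fraction_Field.Fract a 1) = \<theta> a"
  by (simp add: lift_Fract one)

lemma lift_mult: "lift (g * h) = lift g * lift h"
proof (cases g; cases h)
  fix a b c d assume "g = Fraction_Field.Fract a b" "b \<noteq> 0" "h = Fraction_Field.Fract c d" "d \<noteq> 0"
  then show ?thesis by (simp add: lift_Fract mult)
qed

lemma lift_add: "lift (g + h) = lift g + lift h"
proof (cases g; cases h)
  fix a b c d assume *: "g = Fraction_Field.Fract a b" "b \<noteq> 0" "h = Fraction_Field.Fract c d" "d \<noteq> 0"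
  then have "\<theta> b \<noteq> 0" "\<theta> d \<noteq> 0" using eq_0 by blast+
  with * show ?thesis by (simp add: lift_Fract mult add field_simps)
qed

lemma lift_zero [simp]: "lift 0 = 0"
  using lift_add [of 0 0] by (metis add_cancel_right_right add_0)

lemma lift_sum: "lift (\<Sum>x\<in>A. g x) = (\<Sum>x\<in>A. lift (g x))"
  by (induction A rule: infinite_finite_induct) (simp_all add: lift_add)

lemma lift_eq_0: "lift h = 0 \<Longrightarrow> h = 0"
proof (cases h)
  fix a b assume *: "h = Fraction_Field.Fract a b" "b \<noteq> 0" and "lift h = 0"
  then have "\<theta> a / \<theta> b = 0" by (simp add: lift_Fract)
  then have "a = 0" using * eq_0 by fastforce
  with * show ?thesis by (simp add: fract_collapse)
qed

text \<open>
  The equation \<open>h * b = a\<close> and the Leibniz rule determine the derivative of the quotient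
  \<open>h = a / b\<close>, so derivations need to be compared on numerators only.
\<close>

lemma lift_derivation:
  assumes D: "derivation D" and \<Delta>: "derivation \<Delta>"
    and agree: "\<And>a. lift (D (Fraction_Field.Fract a 1)) = \<Delta> (\<theta> a)"
  shows "lift (D h) = \<Delta> (lift h)"
proof (cases h)
  fix a b assume h: "h = Fraction_Field.Fract a b" and b: "b \<noteq> 0"
  let ?a = "Fraction_Field.Fract a 1" and ?b = "Fraction_Field.Fract b 1"
  have ab: "?a = h * ?b" using b by (simp add: h eq_fract)
  have "\<Delta> (lift h) * \<theta> b + lift h * \<Delta> (\<theta> b) = \<Delta> (lift h * \<theta> b)"
    by (simp add: derivation.mult [OF \<Delta>])
  also have "lift h * \<theta> b = \<theta> a"
    using lift_mult [of h ?b] by (simp only: lift_Fract_1 flip: ab)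
  also have "\<Delta> (\<theta> a) = lift (D (h * ?b))"
    using agree [of a] by (simp only: ab)
  also have "\<dots> = lift (D h) * \<theta> b + lift h * \<Delta> (\<theta> b)"
    by (simp only: derivation.mult [OF D] lift_add lift_mult agree lift_Fract_1)
  finally have "\<Delta> (lift h) * \<theta> b = lift (D h) * \<theta> b" by simp
  moreover have "\<theta> b \<noteq> 0" using b eq_0 by blast
  ultimately show ?thesis by simp
qed

end

lemma derivation_fract_eqI:
  fixes D \<Delta> :: "'r::idom fract \<Rightarrow> 'r fract"
  assumes "derivation D" "derivation \<Delta>"
    and "\<And>a. D (Fraction_Field.Fract a 1) = \<Delta> (Fraction_Field.Fract a 1)"
  shows "D h = \<Delta> h"
proof -
  interpret embedding "\<lambda>a :: 'r. Fraction_Field.Fract a 1"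
    by standard (simp_all add: One_fract_def Zero_fract_def eq_fract)
  have "lift g = g" for g
    by (cases g) (simp add: lift_Fract)
  then show ?thesis using lift_derivation [OF assms(1,2), of h] assms(3) by simp
qed

section \<open>Euler derivations of the field of rational functions\<close>

text \<open>
  Unlike the partial derivatives, the Euler derivations \<open>x\<^sub>i \<partial>/\<partial>x\<^sub>i\<close> act diagonally on monomials.
  They turn the quadratic bracket into one with constant coefficients.
\<close>

definition mpoly_euler :: "'n \<Rightarrow> ('n, 'k) mpoly \<Rightarrow> ('n, 'k::comm_ring_1) mpoly" where
  "mpoly_euler i p = Poly_Mapping.single (Poly_Mapping.single i 1) 1 * mpoly_deriv i p"

lemma mpoly_euler_single:
  "mpoly_euler i (Poly_Mapping.single m a) =
    Poly_Mapping.single m (of_nat (Poly_Mapping.lookup m i) * a)"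
proof (cases "Poly_Mapping.lookup m i = 0")
  case False
  then have "Poly_Mapping.single i 1 + (m - Poly_Mapping.single i 1) = m"
    by (intro poly_mapping_eqI) (auto simp: lookup_add lookup_minus lookup_single when_def)
  then show ?thesis by (simp add: mpoly_euler_def mpoly_deriv_single mult_single)
qed (simp add: mpoly_euler_def mpoly_deriv_single)

lemma lookup_mpoly_euler:
  "Poly_Mapping.lookup (mpoly_euler i p) m = of_nat (Poly_Mapping.lookup m i) * Poly_Mapping.lookup p m"
proof (induction p rule: mpoly_single_add_induct)
  case 1
  show ?case by (simp add: mpoly_euler_def)
next
  case (2 l a p)
  have "mpoly_euler i (Poly_Mapping.single l a + p) =
      mpoly_euler i (Poly_Mapping.single l a) + mpoly_euler i p"
    by (simp add: mpoly_euler_def mpoly_deriv_add distrib_left)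
  with 2 show ?case
    by (auto simp: mpoly_euler_single lookup_add lookup_single when_def distrib_left)
qed

interpretation rf_deriv: derivation "rf_deriv i" for i :: "'n::{finite,linorder}"
proof
  fix g h :: "('n, 'b::field) ratfun"
  obtain a b where g: "g = Fraction_Field.Fract a b" "b \<noteq> 0" by (cases g)
  obtain c d where h: "h = Fraction_Field.Fract c d" "d \<noteq> 0" by (cases h)
  show "rf_deriv i (g + h) = rf_deriv i g + rf_deriv i h"
    using g h by (simp add: rf_deriv_Fract eq_fract mpoly_deriv_add mpoly_deriv_mult algebra_simps)
  show "rf_deriv i (g * h) = rf_deriv i g * h + g * rf_deriv i h"
    using g h by (simp add: rf_deriv_Fract eq_fract mpoly_deriv_mult algebra_simps)
qed

definition euler :: "'n::{finite,linorder} \<Rightarrow> ('n, 'k::field) ratfun \<Rightarrow> ('n, 'k) ratfun" where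
  "euler i h = rf_var i * rf_deriv i h"

interpretation euler: derivation "euler i" for i
  by standard (simp_all add: euler_def rf_deriv.add rf_deriv.mult algebra_simps)

lemma euler_Fract_1: "euler i (Fraction_Field.Fract a 1) = Fraction_Field.Fract (mpoly_euler i a) 1"
proof -
  have "mpoly_deriv i 1 = (0 :: ('a, 'b) mpoly)"
    using mpoly_deriv_single [of i 0 "1::'b"] by simp
  then show ?thesis
    by (simp add: euler_def rf_deriv_Fract rf_var_def mpoly_euler_def)
qed

lemma euler_const [simp]: "euler i (rf_const c) = 0"
  by (simp add: rf_const_def euler_Fract_1 mpoly_euler_single Zero_fract_def)

lemma euler_commute:
  fixes h :: "('n::{finite,linorder}, 'k::field) ratfun"
  shows "euler i (euler j h) = euler j (euler i h)"
proof -
  have "euler i (euler j h) - euler j (euler i h) = 0"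
  proof (rule derivation_fract_eqI [where \<Delta> = "\<lambda>_. 0"
        and D = "\<lambda>h. euler i (euler j h) - euler j (euler i h)"])
    show "derivation (\<lambda>h :: ('n, 'k) ratfun. euler i (euler j h) - euler j (euler i h))"
      by standard (simp_all add: euler.add euler.mult algebra_simps)
    show "euler i (euler j (Fraction_Field.Fract a 1)) - euler j (euler i (Fraction_Field.Fract a 1)) = 0" for a :: "('n, 'k) mpoly"
    proof -
      have "mpoly_euler i (mpoly_euler j a) = mpoly_euler j (mpoly_euler i a)"
        by (rule poly_mapping_eqI) (simp add: lookup_mpoly_euler)
      then show ?thesis by (simp add: euler_Fract_1)
    qed
  qed (standard, simp_all)
  then show ?thesis by simp
qed

lemma rf_const_add: "rf_const (a + b) = rf_const a + rf_const b"
  and rf_const_mult: "rf_const (a * b) = rf_const a * rf_const b"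
  and rf_const_0: "rf_const 0 = 0"
  and rf_const_1: "rf_const 1 = 1"
  and rf_const_uminus: "rf_const (- a) = - rf_const a"
  by (simp_all add: rf_const_def single_add mult_single Zero_fract_def One_fract_def single_uminus)

lemma rf_const_eq_0_iff: "rf_const a = 0 \<longleftrightarrow> a = 0"
  by (auto simp: rf_const_def Zero_fract_def eq_fract) (metis lookup_single_eq lookup_zero)

section \<open>The bracket as a divergence\<close>

text \<open>
  The off-diagonal terms cancel in pairs, which is why the diagonal has to vanish separately when
  \<open>2 = 0\<close>.
\<close>

lemma skew_symmetric_sum_eq_0:
  fixes \<Omega> :: "'k::field ^ 'n::{finite,linorder} ^ 'n::{finite,linorder}"
    and s :: "'n \<Rightarrow> 'n \<Rightarrow> ('n, 'k) ratfun"
  assumes skew: "skew_symmetric \<Omega>" and sym: "\<And>i j. s i j = s j i"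
  shows "(\<Sum>i\<in>UNIV. \<Sum>j\<in>UNIV. rf_const (\<Omega> $ i $ j) * s i j) = 0"
proof -
  define t where "t = (\<lambda>(i, j). rf_const (\<Omega> $ i $ j) * s i j)"
  have swap: "t (j, i) = - t (i, j)" for i j
  proof -
    have "\<Omega> $ j $ i = - \<Omega> $ i $ j"
      using skew unfolding skew_symmetric_def by blast
    then show ?thesis by (simp add: t_def rf_const_uminus sym [of j i])
  qed
  have diag: "t (i, i) = 0" for i
  proof -
    have "\<Omega> $ i $ i = 0"
      using skew unfolding skew_symmetric_def by blast
    then show ?thesis by (simp add: t_def rf_const_0)
  qed
  let ?L = "{(i :: 'n, j). i < j}" and ?G = "{(i :: 'n, j). j < i}" and ?E = "{(i :: 'n, j). i = j}"
  have "(\<Sum>i\<in>UNIV. \<Sum>j\<in>UNIV. rf_const (\<Omega> $ i $ j) * s i j) = sum t UNIV"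
    by (simp add: sum.cartesian_product t_def)
  also have "UNIV = (?L \<union> ?G) \<union> ?E"
    by (auto simp: not_less_iff_gr_or_eq)
  also have "sum t \<dots> = sum t (?L \<union> ?G) + sum t ?E"
    by (rule sum.union_disjoint [OF finite finite]) auto
  also have "sum t (?L \<union> ?G) = sum t ?L + sum t ?G"
    by (rule sum.union_disjoint [OF finite finite]) auto
  also have "sum t ?G = (\<Sum>(i, j)\<in>?L. t (j, i))"
    by (rule sum.reindex_bij_witness [of _ prod.swap prod.swap]) auto
  also have "\<dots> = - sum t ?L"
    unfolding sum_negf [symmetric]
    by (intro sum.cong refl, split prod.split, intro allI impI) (simp only:, rule swap)
  also have "sum t ?E = 0"
    by (rule sum.neutral) (auto simp: diag)
  finally show ?thesis by simp
qed

lemma rf_bracket_euler: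
  "rf_bracket \<Omega> f g = (\<Sum>i\<in>UNIV. \<Sum>j\<in>UNIV. rf_const (\<Omega> $ i $ j) * (euler i f * euler j g))"
  unfolding rf_bracket_def euler_def by (intro sum.cong refl) (simp only: ac_simps)

interpretation rf_bracket_right: derivation "rf_bracket \<Omega> f" for \<Omega> f
proof
  show "rf_bracket \<Omega> f (g + h) = rf_bracket \<Omega> f g + rf_bracket \<Omega> f h" for g h
    by (simp add: rf_bracket_euler euler.add sum.distrib distrib_left)
  show "rf_bracket \<Omega> f (g * h) = rf_bracket \<Omega> f g * h + g * rf_bracket \<Omega> f h" for g h
    unfolding rf_bracket_euler euler.mult sum_distrib_left sum_distrib_right sum.distrib [symmetric]
    by (intro sum.cong refl) (simp add: algebra_simps)
qed

interpretation rf_bracket_left: derivation "\<lambda>f. rf_bracket \<Omega> f g" for \<Omega> g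
proof
  show "rf_bracket \<Omega> (f + h) g = rf_bracket \<Omega> f g + rf_bracket \<Omega> h g" for f h
    by (simp add: rf_bracket_euler euler.add sum.distrib distrib_left distrib_right)
  show "rf_bracket \<Omega> (f * h) g = rf_bracket \<Omega> f g * h + f * rf_bracket \<Omega> h g" for f h
    unfolding rf_bracket_euler euler.mult sum_distrib_left sum_distrib_right sum.distrib [symmetric]
    by (intro sum.cong refl) (simp add: algebra_simps)
qed

lemma rf_bracket_const_right [simp]: "rf_bracket \<Omega> f (rf_const c) = 0"
  by (simp add: rf_bracket_euler)

lemma rf_bracket_self:
  assumes "skew_symmetric \<Omega>"
  shows "rf_bracket \<Omega> f f = 0"
  unfolding rf_bracket_euler by (rule skew_symmetric_sum_eq_0 [OF assms]) (rule mult.commute)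

text \<open>
  The vector field \<open>X\<^sub>j = \<Sum>\<^sub>i \<omega>\<^sub>i\<^sub>j E\<^sub>i f\<close> is divergence free, since
  \<open>\<Sum>\<^sub>j E\<^sub>j X\<^sub>j = \<Sum> \<omega>\<^sub>i\<^sub>j E\<^sub>j E\<^sub>i f\<close> pairs a skew matrix with a symmetric one. Hence
  \<open>{f, g} = \<Sum>\<^sub>j X\<^sub>j E\<^sub>j g\<close> equals \<open>\<Sum>\<^sub>j E\<^sub>j (g X\<^sub>j)\<close>.
\<close>

lemma rf_bracket_divergence:
  assumes "skew_symmetric \<Omega>"
  shows "rf_bracket \<Omega> f g =
    (\<Sum>j\<in>UNIV. euler j (g * (\<Sum>i\<in>UNIV. rf_const (\<Omega> $ i $ j) * euler i f)))"
proof -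
  have "(\<Sum>i\<in>UNIV. \<Sum>j\<in>UNIV. rf_const (\<Omega> $ i $ j) * euler j (euler i f)) = 0"
    by (rule skew_symmetric_sum_eq_0 [OF assms]) (rule euler_commute)
  then have div: "(\<Sum>j\<in>UNIV. \<Sum>i\<in>UNIV. rf_const (\<Omega> $ i $ j) * euler j (euler i f)) = 0"
    by (subst sum.swap)
  have "(\<Sum>j\<in>UNIV. euler j (g * (\<Sum>i\<in>UNIV. rf_const (\<Omega> $ i $ j) * euler i f))) =
      (\<Sum>j\<in>UNIV. \<Sum>i\<in>UNIV. rf_const (\<Omega> $ i $ j) * (euler i f * euler j g)) +
      g * (\<Sum>j\<in>UNIV. \<Sum>i\<in>UNIV. rf_const (\<Omega> $ i $ j) * euler j (euler i f))"
    unfolding euler.mult euler.sum sum_distrib_left sum.distrib [symmetric]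
    by (intro sum.cong refl) (simp add: euler.mult algebra_simps)
  also have "\<dots> = rf_bracket \<Omega> f g"
    unfolding div rf_bracket_euler by (subst sum.swap) simp
  finally show ?thesis by simp
qed

section \<open>Laurent expansion along a variable\<close>

notation fls_nth (infixl \<open>$$\<close> 75)

definition fls_map :: "('a::comm_ring_1 \<Rightarrow> 'a) \<Rightarrow> 'a fls \<Rightarrow> 'a fls" where
  "fls_map D f = Abs_fls (\<lambda>k. D (f $$ k))"

context derivation
begin

lemma fls_map_nth: "fls_map D f $$ k = D (f $$ k)"
  unfolding fls_map_def by (rule nth_Abs_fls_lower_bound [of "fls_subdegree f"]) simp

text \<open>
  The Leibniz rule holds coefficientwise once the three products in it are written as sums over the
  same range; the derivation can raise the subdegree of a series but never lower it.
\<close>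

lemma derivation_fls_map: "derivation (fls_map D)"
proof
  fix f g :: "'a fls"
  show "fls_map D (f + g) = fls_map D f + fls_map D g"
    by (rule fls_eqI) (simp add: fls_map_nth add)
  define a b where "a = fls_subdegree f" and "b = fls_subdegree g"
  have nth: "(u * v) $$ n = (\<Sum>i=a..n - b. u $$ i * v $$ (n - i))"
    if u: "\<And>i. i < a \<Longrightarrow> u $$ i = 0" and v: "\<And>i. i < b \<Longrightarrow> v $$ i = 0" for u v :: "'a fls" and n
  proof -
    consider "u = 0" | "v = 0" | "a \<le> fls_subdegree u" "b \<le> fls_subdegree v"
      using u v by (metis fls_subdegree_geI)
    then show ?thesis
    proof cases
      case 3
      then show ?thesis
        unfolding fls_times_nth(2) by (intro sum.mono_neutral_left) auto
    qed simp_all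
  qed
  show "fls_map D (f * g) = fls_map D f * g + f * fls_map D g"
  proof (rule fls_eqI)
    fix n
    have "f $$ i = 0" if "i < a" for i using that by (simp add: a_def)
    moreover have "g $$ i = 0" if "i < b" for i using that by (simp add: b_def)
    ultimately show "fls_map D (f * g) $$ n = (fls_map D f * g + f * fls_map D g) $$ n"
      by (simp add: nth fls_map_nth sum mult sum.distrib)
  qed
qed

end

lift_definition mpoly_part :: "'n \<Rightarrow> nat \<Rightarrow> ('n, 'k) mpoly \<Rightarrow> ('n, 'k::comm_ring_1) mpoly"
  is "\<lambda>i k p m. if Poly_Mapping.lookup m i = k then p m else 0"
  by (erule rev_finite_subset) auto

lemma mpoly_part_add: "mpoly_part i k (p + q) = mpoly_part i k p + mpoly_part i k q"
  by (rule poly_mapping_eqI) (simp add: mpoly_part.rep_eq lookup_add)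

lemma mpoly_part_0 [simp]: "mpoly_part i k 0 = 0"
  by (rule poly_mapping_eqI) (simp add: mpoly_part.rep_eq)

lemma mpoly_part_single:
  "mpoly_part i k (Poly_Mapping.single m a) = (if k = Poly_Mapping.lookup m i then Poly_Mapping.single m a else 0)"
  by (rule poly_mapping_eqI) (auto simp: mpoly_part.rep_eq lookup_single when_def)

lemma mpoly_part_euler: "mpoly_part i k (mpoly_euler j p) = mpoly_euler j (mpoly_part i k p)"
  by (rule poly_mapping_eqI) (simp add: mpoly_part.rep_eq lookup_mpoly_euler)

lemma mpoly_euler_part: "mpoly_euler i (mpoly_part i k p) = of_nat k * mpoly_part i k p"
proof (rule poly_mapping_eqI)
  fix m
  have "Poly_Mapping.lookup (of_nat k * q) m = of_nat k * Poly_Mapping.lookup q m" for q :: "('a, 'b) mpoly"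
    by (induction k) (simp_all add: distrib_right lookup_add)
  then show "Poly_Mapping.lookup (mpoly_euler i (mpoly_part i k p)) m =
      Poly_Mapping.lookup (of_nat k * mpoly_part i k p) m"
    by (simp add: mpoly_part.rep_eq lookup_mpoly_euler)
qed

text \<open>
  The substitution \<open>x\<^sub>i \<mapsto> x\<^sub>i t\<close>, which leaves the other variables alone. Keeping \<open>x\<^sub>i\<close> in the
  coefficients, instead of mapping it to \<open>t\<close>, has the effect that the coefficients lie in the
  original field of rational functions, so that the expansions along different variables can be
  composed, and that the substitution commutes with all Euler derivations.
\<close>

definition scaled_fps :: "'n \<Rightarrow> ('n::{finite,linorder}, 'k::field) mpoly \<Rightarrow> ('n, 'k) ratfun fps" where
  "scaled_fps i p = Abs_fps (\<lambda>k. Fraction_Field.Fract (mpoly_part i k p) 1)"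

lemma scaled_fps_add: "scaled_fps i (p + q) = scaled_fps i p + scaled_fps i q"
  by (rule fps_ext) (simp add: scaled_fps_def mpoly_part_add)

lemma scaled_fps_0: "scaled_fps i 0 = 0"
  by (rule fps_ext) (simp add: scaled_fps_def Zero_fract_def)

lemma scaled_fps_single:
  "scaled_fps i (Poly_Mapping.single m a) =
    fps_const (Fraction_Field.Fract (Poly_Mapping.single m a) 1) * fps_X ^ Poly_Mapping.lookup m i"
  by (rule fps_ext)
    (simp add: scaled_fps_def mpoly_part_single fps_X_power_nth Zero_fract_def)

lemma scaled_fps_mult: "scaled_fps i (p * q) = scaled_fps i p * scaled_fps i q"
proof (induction p rule: mpoly_single_add_induct)
  case 1
  show ?case by (simp add: scaled_fps_0)
next
  case (2 m a p)
  have "scaled_fps i (Poly_Mapping.single m a * q) = scaled_fps i (Poly_Mapping.single m a) * scaled_fps i q"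
  proof (induction q rule: mpoly_single_add_induct)
    case 1
    show ?case by (simp add: scaled_fps_0)
  next
    case (2 l b q)
    have "scaled_fps i (Poly_Mapping.single m a * Poly_Mapping.single l b) =
        scaled_fps i (Poly_Mapping.single m a) * scaled_fps i (Poly_Mapping.single l b)"
    proof -
      have "fps_const (Fraction_Field.Fract (Poly_Mapping.single (m + l) (a * b)) 1) =
          fps_const (Fraction_Field.Fract (Poly_Mapping.single m a) 1) *
          fps_const (Fraction_Field.Fract (Poly_Mapping.single l b) 1)"
        by (simp add: mult_single)
      then show ?thesis
        by (simp only: mult_single scaled_fps_single lookup_add power_add ac_simps)
    qed
    with 2 show ?case by (simp add: scaled_fps_add distrib_left)
  qed
  with 2 show ?case by (simp add: scaled_fps_add distrib_right)
qed

definition scaled :: "'n \<Rightarrow> ('n::{finite,linorder}, 'k::field) mpoly \<Rightarrow> ('n, 'k) ratfun fls" where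
  "scaled i p = fps_to_fls (scaled_fps i p)"

lemma scaled_nth:
  "scaled i p $$ k = (if k < 0 then 0 else Fraction_Field.Fract (mpoly_part i (nat k) p) 1)"
  by (simp add: scaled_def scaled_fps_def)

lemma scaled_const: "scaled i (Poly_Mapping.single 0 c) = fls_const (rf_const c)"
  by (simp add: scaled_def scaled_fps_single rf_const_def fls_const_def)

interpretation scaled: embedding "scaled i" for i
proof
  fix p q :: "('a::{finite,linorder}, 'b::field) mpoly"
  show "scaled i (p + q) = scaled i p + scaled i q"
    by (simp add: scaled_def scaled_fps_add)
  show "scaled i (p * q) = scaled i p * scaled i q"
    by (simp add: scaled_def scaled_fps_mult fls_times_fps_to_fls)
  show "scaled i (1 :: ('a, 'b) mpoly) = 1"
    using scaled_const [of i "1::'b"] by (simp add: rf_const_1)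
  assume zero: "scaled i p = 0"
  show "p = 0"
  proof (rule poly_mapping_eqI)
    fix m :: "'a \<Rightarrow>\<^sub>0 nat"
    let ?k = "Poly_Mapping.lookup m i"
    have "mpoly_part i ?k p = 0"
      using zero scaled_nth [of i p "int ?k"] by (simp add: Zero_fract_def eq_fract)
    then have "Poly_Mapping.lookup (mpoly_part i ?k p) m = 0" by simp
    then show "Poly_Mapping.lookup p m = Poly_Mapping.lookup 0 m"
      by (simp add: mpoly_part.rep_eq)
  qed
qed

text \<open>
  The part of degree \<open>0\<close> in \<open>x\<^sub>i\<close> of the expansion of a rational function in powers of \<open>x\<^sub>i\<close>.
\<close>

definition const_term :: "'n::{finite,linorder} \<Rightarrow> ('n, 'k::field) ratfun \<Rightarrow> ('n, 'k) ratfun" where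
  "const_term i h = scaled.lift i h $$ 0"

lemma const_term_add: "const_term i (g + h) = const_term i g + const_term i h"
  by (simp add: const_term_def scaled.lift_add)

lemma const_term_0 [simp]: "const_term i 0 = 0"
  by (simp add: const_term_def)

lemma const_term_const: "const_term i (rf_const c) = rf_const c"
  using scaled_const [of i c]
  by (simp add: const_term_def rf_const_def scaled.lift_Fract_1)

lemma const_term_euler_commute: "const_term i (euler j h) = euler j (const_term i h)"
proof -
  have "scaled.lift i (euler j h) = fls_map (euler j) (scaled.lift i h)"
    by (rule scaled.lift_derivation [OF euler.derivation_axioms euler.derivation_fls_map])
      (auto intro!: fls_eqI simp: euler_Fract_1 scaled.lift_Fract_1 scaled_nth euler.fls_map_nth mpoly_part_euler)
  then show ?thesis by (simp add: const_term_def euler.fls_map_nth)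
qed

text \<open>
  Under the substitution \<open>x\<^sub>i \<mapsto> x\<^sub>i t\<close> the derivation \<open>x\<^sub>i \<partial>/\<partial>x\<^sub>i\<close> becomes \<open>t d/dt\<close>, and a series
  \<open>t d/dt F\<close> has no constant term.
\<close>

lemma const_term_euler_self: "const_term i (euler i h) = 0"
proof -
  have "derivation (\<lambda>f :: ('a, 'b) ratfun fls. fls_X * fls_deriv f)"
    by standard (simp_all add: algebra_simps)
  then have "scaled.lift i (euler i h) = fls_X * fls_deriv (scaled.lift i h)"
  proof (rule scaled.lift_derivation [OF euler.derivation_axioms])
    fix p :: "('a, 'b) mpoly"
    show "scaled.lift i (euler i (Fraction_Field.Fract p 1)) = fls_X * fls_deriv (scaled i p)"
    proof (rule fls_eqI)
      fix n
      show "scaled.lift i (euler i (Fraction_Field.Fract p 1)) $$ n = (fls_X * fls_deriv (scaled i p)) $$ n"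
        by (auto simp: euler_Fract_1 scaled.lift_Fract_1 scaled_nth fls_X_times_conv_shift
            mpoly_part_euler mpoly_euler_part of_nat_fract simp flip: of_nat_nat)
    qed
  qed
  then show ?thesis by (simp add: const_term_def fls_X_times_conv_shift)
qed

definition full_const_term :: "('n::{finite,linorder}, 'k::field) ratfun \<Rightarrow> ('n, 'k) ratfun" where
  "full_const_term = foldr const_term (sorted_list_of_set UNIV)"

text \<open>
  The Euler derivation of \<open>x\<^sub>j\<close> can be moved past the other constant terms until it meets the one
  along \<open>x\<^sub>j\<close>, which kills it.
\<close>

lemma full_const_term_euler: "full_const_term (euler j h) = 0"
proof -
  have "foldr const_term is (euler j h) = euler j (foldr const_term is h)" for "is"
    by (induction "is") (simp_all add: const_term_euler_commute)
  then have "j \<in> set is \<Longrightarrow> foldr const_term is (euler j h) = 0" for "is"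
    by (induction "is") (auto simp: const_term_euler_self)
  then show ?thesis by (simp add: full_const_term_def)
qed

lemma full_const_term_const: "full_const_term (rf_const c) = rf_const c"
proof -
  have "foldr const_term is (rf_const c) = rf_const c" for "is"
    by (induction "is") (simp_all add: const_term_const)
  then show ?thesis by (simp add: full_const_term_def)
qed

lemma full_const_term_0 [simp]: "full_const_term 0 = 0"
  using full_const_term_const [of 0] by (simp add: rf_const_0)

lemma full_const_term_add: "full_const_term (g + h) = full_const_term g + full_const_term h"
proof -
  have "foldr const_term is (g + h) = foldr const_term is g + foldr const_term is h" for "is"
    by (induction "is") (simp_all add: const_term_add)
  then show ?thesis by (simp add: full_const_term_def)
qed

lemma full_const_term_sum: "full_const_term (\<Sum>x\<in>A. g x) = (\<Sum>x\<in>A. full_const_term (g x))"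
  by (induction A rule: infinite_finite_induct) (simp_all add: full_const_term_add)

lemma rf_bracket_eq_const_imp_0:
  assumes "skew_symmetric \<Omega>" and "rf_bracket \<Omega> f g = rf_const c"
  shows "c = 0"
proof -
  have "rf_const c = full_const_term (rf_bracket \<Omega> f g)"
    by (simp add: assms(2) full_const_term_const)
  also have "\<dots> = 0"
    by (simp add: rf_bracket_divergence [OF assms(1)] full_const_term_sum full_const_term_euler)
  finally show ?thesis by (simp add: rf_const_eq_0_iff)
qed

section \<open>Polynomials in a linear operator\<close>

locale linear_operator = vector_space scale
  for scale :: "'a::field \<Rightarrow> 'b::ab_group_add \<Rightarrow> 'b" (infixr \<open>\<cdot>\<close> 75) +
  fixes D :: "'b \<Rightarrow> 'b"
  assumes hom: "module_hom scale scale D"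
begin

sublocale D: module_hom scale scale D
  by (fact hom)

definition poly_op :: "'a poly \<Rightarrow> 'b \<Rightarrow> 'b" where
  "poly_op p v = (\<Sum>k\<le>degree p. coeff p k \<cdot> (D ^^ k) v)"

lemma poly_op_altdef:
  assumes "degree p \<le> n"
  shows "poly_op p v = (\<Sum>k\<le>n. coeff p k \<cdot> (D ^^ k) v)"
  unfolding poly_op_def using assms
  by (intro sum.mono_neutral_left) (auto simp: coeff_eq_0)

lemma poly_op_linear_factor_mult: "poly_op ([:- a, 1:] * q) v = poly_op q (D v - a \<cdot> v)"
proof -
  let ?n = "degree q" and ?p = "[:- a, 1:] * q"
  have pow: "(D ^^ k) (D v - a \<cdot> v) = (D ^^ Suc k) v - a \<cdot> (D ^^ k) v" for k
    by (induction k) (simp_all add: D.diff D.scale)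
  have coeff_p: "coeff ?p k = (case k of 0 \<Rightarrow> 0 | Suc l \<Rightarrow> coeff q l) - a * coeff q k" for k
    by (cases k) simp_all
  have "degree ?p \<le> Suc ?n"
    using degree_mult_le [of "[:- a, 1:]" q] by simp
  then have "poly_op ?p v = (\<Sum>k\<le>Suc ?n. coeff ?p k \<cdot> (D ^^ k) v)"
    by (rule poly_op_altdef)
  also have "\<dots> = (\<Sum>k\<le>Suc ?n. (case k of 0 \<Rightarrow> 0 | Suc l \<Rightarrow> coeff q l) \<cdot> (D ^^ k) v) -
      (\<Sum>k\<le>Suc ?n. (a * coeff q k) \<cdot> (D ^^ k) v)"
    by (simp only: coeff_p scale_left_diff_distrib sum_subtractf)
  also have "(\<Sum>k\<le>Suc ?n. (case k of 0 \<Rightarrow> 0 | Suc l \<Rightarrow> coeff q l) \<cdot> (D ^^ k) v) =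
      (\<Sum>k\<le>?n. coeff q k \<cdot> (D ^^ Suc k) v)"
    by (subst sum.atMost_Suc_shift) simp
  also have "(\<Sum>k\<le>Suc ?n. (a * coeff q k) \<cdot> (D ^^ k) v) = (\<Sum>k\<le>?n. coeff q k \<cdot> (a \<cdot> (D ^^ k) v))"
    by (simp add: coeff_eq_0 mult.commute)
  also have "(\<Sum>k\<le>?n. coeff q k \<cdot> (D ^^ Suc k) v) - \<dots> = poly_op q (D v - a \<cdot> v)"
    unfolding poly_op_def pow scale_right_diff_distrib sum_subtractf ..
  finally show ?thesis .
qed

text \<open>
  The iterates \<open>v, D v, D\<^sup>2 v, \<dots>\<close> stay in the span of \<open>B\<close>, so the first \<open>card B + 1\<close> of them
  cannot be both distinct and independent. Either failure is a polynomial relation.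
\<close>

lemma ex_annihilating_poly:
  assumes fin: "finite B" and "D ` B \<subseteq> span B" and v: "v \<in> span B"
  shows "\<exists>p. p \<noteq> 0 \<and> poly_op p v = 0"
proof -
  have "D w \<in> span B" if "w \<in> span B" for w
    using D.span_image [of B] span_minimal [OF assms(2) subspace_span] that by blast
  then have krylov: "(D ^^ k) v \<in> span B" for k
    by (induction k) (use v in auto)
  show ?thesis
  proof (cases "inj_on (\<lambda>k. (D ^^ k) v) {..card B}")
    case False
    then obtain i j where ij: "i < j" "(D ^^ i) v = (D ^^ j) v"
      unfolding inj_on_def by (metis linorder_neqE_nat)
    \<comment> \<open>Two iterates agree: the relation is \<open>t\<^sup>j - t\<^sup>i\<close>.\<close>
    let ?p = "monom 1 j - monom 1 i :: 'a poly"
    have "coeff ?p j \<noteq> 0" using ij by simp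
    then have "?p \<noteq> 0" by (metis coeff_0)
    moreover have "degree ?p \<le> j"
      using ij by (intro degree_le) simp
    then have "poly_op ?p v = (\<Sum>k\<le>j. (if k = j then (D ^^ k) v else 0) - (if k = i then (D ^^ k) v else 0))"
      unfolding poly_op_altdef [OF \<open>degree ?p \<le> j\<close>]
      by (intro sum.cong refl) (auto simp: scale_left_diff_distrib)
    then have "poly_op ?p v = 0"
      using ij by (simp add: sum_subtractf)
    ultimately show ?thesis by blast
  next
    case True
    \<comment> \<open>The iterates are distinct, so a linear dependence among them has well-defined coefficients.\<close>
    let ?S = "(\<lambda>k. (D ^^ k) v) ` {..card B}"
    have "dependent ?S"
    proof (rule ccontr)
      assume "independent ?S"
      with fin krylov have "card ?S \<le> card B"
        by (intro independent_span_bound [THEN conjunct2]) auto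
      with True show False by (simp add: card_image)
    qed
    then obtain u where u: "\<exists>w\<in>?S. u w \<noteq> 0" "(\<Sum>w\<in>?S. u w \<cdot> w) = 0"
      by (subst (asm) dependent_finite) auto
    let ?c = "\<lambda>k. u ((D ^^ k) v)"
    define p where "p = (\<Sum>k\<le>card B. monom (?c k) k)"
    have coeff_p: "coeff p k = (if k \<le> card B then ?c k else 0)" for k
      by (simp add: p_def coeff_sum)
    have "p \<noteq> 0"
    proof -
      from u(1) obtain k where "k \<le> card B" "?c k \<noteq> 0" by auto
      then have "coeff p k \<noteq> 0" by (simp add: coeff_p)
      then show ?thesis by auto
    qed
    moreover have "degree p \<le> card B"
      by (rule degree_le) (simp add: coeff_p)
    then have "poly_op p v = (\<Sum>k\<le>card B. ?c k \<cdot> (D ^^ k) v)"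
      unfolding poly_op_altdef [OF \<open>degree p \<le> card B\<close>]
      by (intro sum.cong refl) (simp add: coeff_p)
    then have "poly_op p v = 0"
      using u(2) by (simp add: sum.reindex [OF True])
    ultimately show ?thesis by blast
  qed
qed

end

section \<open>The Hamiltonian derivations are locally finite only where they vanish\<close>

interpretation rf: vector_space "\<lambda>c h. rf_const c * h"
  by standard (simp_all add: algebra_simps rf_const_add rf_const_mult rf_const_1)

interpretation hamiltonian: linear_operator "\<lambda>c h. rf_const c * h" "rf_bracket \<Omega> f" for \<Omega> f
  by standard
    (simp_all add: algebra_simps rf_const_add rf_const_mult rf_const_1 rf_bracket_right.add rf_bracket_right.mult)

text \<open>
  Since \<open>{g, g} = 0\<close>, the Leibniz rule in the first argument gives \<open>{f / g, g} = {f, g} / g = c\<close>,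
  a constant bracket.
\<close>

lemma rf_bracket_eigenvalue_0:
  assumes skew: "skew_symmetric \<Omega>" and eigen: "rf_bracket \<Omega> f g = rf_const c * g" and "g \<noteq> 0"
  shows "c = 0"
proof (rule rf_bracket_eq_const_imp_0 [OF skew])
  have "rf_bracket \<Omega> (f / g * g) g = rf_bracket \<Omega> (f / g) g * g + f / g * rf_bracket \<Omega> g g"
    by (rule rf_bracket_left.mult)
  then show "rf_bracket \<Omega> (f / g) g = rf_const c"
    using eigen \<open>g \<noteq> 0\<close> by (simp add: rf_bracket_self [OF skew])
qed

text \<open>
  If \<open>h = {f, g}\<close> were nonzero, it could be treated as a constant, because \<open>{f, h} = 0\<close>, and then
  \<open>{f, g / h} = 1\<close>.
\<close>

lemma rf_bracket_nilpotent:
  assumes skew: "skew_symmetric \<Omega>" and "rf_bracket \<Omega> f (rf_bracket \<Omega> f g) = 0"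
  shows "rf_bracket \<Omega> f g = 0"
proof (rule ccontr)
  let ?h = "rf_bracket \<Omega> f g"
  assume h: "?h \<noteq> 0"
  have "?h = rf_bracket \<Omega> f (g / ?h * ?h)"
    using h by simp
  also have "\<dots> = rf_bracket \<Omega> f (g / ?h) * ?h"
    unfolding rf_bracket_right.mult assms(2) by simp
  finally have "rf_bracket \<Omega> f (g / ?h) = rf_const 1"
    using h by (simp add: rf_const_1)
  from rf_bracket_eq_const_imp_0 [OF skew this] show False by simp
qed

text \<open>
  Induction on the degree of \<open>p\<close>. Splitting off a linear factor \<open>t - a\<close> and applying the induction
  hypothesis to \<open>D g - a g\<close> shows that \<open>D g\<close>, unless it is zero, is an eigenvector with
  eigenvalue \<open>a\<close>. Then \<open>a = 0\<close>, so \<open>D\<^sup>2 g = 0\<close> and \<open>D g = 0\<close> after all.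
\<close>

lemma rf_bracket_locally_finite:
  fixes \<Omega> :: "'k::alg_closed_field ^ 'n::{finite,linorder} ^ 'n::{finite,linorder}"
  assumes skew: "skew_symmetric \<Omega>" and "p \<noteq> 0" and "hamiltonian.poly_op \<Omega> f p g = 0"
  shows "rf_bracket \<Omega> f g = 0"
  using assms(2,3)
proof (induction "degree p" arbitrary: p g)
  case 0
  then obtain c where "p = [:c:]" "c \<noteq> 0"
    by (metis degree_eq_zeroE pCons_0_0)
  with 0 have "g = 0" by (simp add: hamiltonian.poly_op_def rf_const_eq_0_iff)
  then show ?case by simp
next
  case (Suc n)
  let ?D = "rf_bracket \<Omega> f"
  from Suc.hyps(2) obtain a where "poly p a = 0"
    using alg_closed_imp_poly_has_root [of p] by auto
  then obtain q where q: "p = [:- a, 1:] * q"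
    by (auto simp: poly_eq_0_iff_dvd)
  have "q \<noteq> 0" using Suc.prems(1) q by auto
  then have "n = degree q"
    using Suc.hyps(2) by (simp add: q degree_mult_eq del: mult_pCons_left)
  moreover have "hamiltonian.poly_op \<Omega> f q (?D g - rf_const a * g) = 0"
    using Suc.prems(2) by (simp only: q hamiltonian.poly_op_linear_factor_mult)
  ultimately have "?D (?D g - rf_const a * g) = 0"
    using Suc.hyps(1) \<open>q \<noteq> 0\<close> by blast
  then have eigen: "?D (?D g) = rf_const a * ?D g"
    by (simp add: rf_bracket_right.diff rf_bracket_right.mult)
  show ?case
  proof (rule ccontr)
    assume "?D g \<noteq> 0"
    then have "a = 0" by (rule rf_bracket_eigenvalue_0 [OF skew eigen])
    with eigen have "?D (?D g) = 0" by (simp add: rf_const_0)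
    with \<open>?D g \<noteq> 0\<close> show False using rf_bracket_nilpotent [OF skew] by blast
  qed
qed

lemma rf_bracket_eq_0_alg_closed:
  fixes \<Omega> :: "'k::alg_closed_field ^ 'n::{finite,linorder} ^ 'n::{finite,linorder}"
    and f :: "'i::finite \<Rightarrow> ('n, 'k) ratfun"
  assumes skew: "skew_symmetric \<Omega>"
    and closed: "\<And>i j. rf_bracket \<Omega> (f i) (f j) = (\<Sum>k\<in>UNIV. rf_const (c k i j) * f k) + rf_const (d i j)"
  shows "rf_bracket \<Omega> (f i) (f j) = 0"
proof -
  let ?B = "insert 1 (range f)"
  have const: "rf_const a \<in> rf.span ?B" for a
    using rf.span_scale [OF rf.span_base [of 1 ?B], of a] by simp
  have "rf_bracket \<Omega> (f i) 1 = 0"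
    using rf_bracket_const_right [of \<Omega> "f i" 1] by (simp add: rf_const_1)
  moreover have "rf_bracket \<Omega> (f i) (f l) \<in> rf.span ?B" for l
    unfolding closed by (intro rf.span_add rf.span_sum rf.span_scale const rf.span_base) auto
  ultimately have "rf_bracket \<Omega> (f i) ` ?B \<subseteq> rf.span ?B"
    by (auto simp: rf.span_zero)
  moreover have "f j \<in> rf.span ?B" by (intro rf.span_base) auto
  ultimately have "\<exists>p. p \<noteq> 0 \<and> hamiltonian.poly_op \<Omega> (f i) p (f j) = 0"
    by (intro hamiltonian.ex_annihilating_poly [of ?B]) auto
  then show ?thesis using rf_bracket_locally_finite [OF skew] by blast
qed

section \<open>Extension of scalars to the algebraic closure\<close>

definition mpoly_to_ac :: "('n, 'k::field) mpoly \<Rightarrow> ('n, 'k alg_closure) mpoly" where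
  "mpoly_to_ac = Poly_Mapping.map to_ac"

lemma lookup_mpoly_to_ac: "Poly_Mapping.lookup (mpoly_to_ac p) m = to_ac (Poly_Mapping.lookup p m)"
  by (simp add: mpoly_to_ac_def Poly_Mapping.map.rep_eq when_def)

lemma mpoly_to_ac_single: "mpoly_to_ac (Poly_Mapping.single m a) = Poly_Mapping.single m (to_ac a)"
  by (rule poly_mapping_eqI) (simp add: lookup_mpoly_to_ac lookup_single when_def)

lemma mpoly_to_ac_add: "mpoly_to_ac (p + q) = mpoly_to_ac p + mpoly_to_ac q"
  by (rule poly_mapping_eqI) (simp add: lookup_mpoly_to_ac lookup_add)

lemma mpoly_to_ac_0 [simp]: "mpoly_to_ac 0 = 0"
  by (rule poly_mapping_eqI) (simp add: lookup_mpoly_to_ac)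

lemma mpoly_to_ac_mult: "mpoly_to_ac (p * q) = mpoly_to_ac p * mpoly_to_ac q"
proof (induction p rule: mpoly_single_add_induct)
  case 1
  show ?case by simp
next
  case (2 m a p)
  have "mpoly_to_ac (Poly_Mapping.single m a * q) = mpoly_to_ac (Poly_Mapping.single m a) * mpoly_to_ac q"
    by (induction q rule: mpoly_single_add_induct)
      (simp_all add: mpoly_to_ac_add mpoly_to_ac_single mult_single distrib_left)
  with 2 show ?case by (simp add: mpoly_to_ac_add distrib_right)
qed

lemma mpoly_to_ac_euler: "mpoly_to_ac (mpoly_euler i p) = mpoly_euler i (mpoly_to_ac p)"
  by (rule poly_mapping_eqI) (simp add: lookup_mpoly_to_ac lookup_mpoly_euler)

interpretation to_ac: embedding
  "\<lambda>p :: ('n::{finite,linorder}, 'k::field) mpoly. Fraction_Field.Fract (mpoly_to_ac p) 1"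
proof
  fix p q :: "('n, 'k) mpoly"
  show "Fraction_Field.Fract (mpoly_to_ac (1 :: ('n, 'k) mpoly)) 1 = 1"
    using mpoly_to_ac_single [of "0 :: 'n \<Rightarrow>\<^sub>0 nat" "1 :: 'k"] by (simp add: One_fract_def)
  assume "Fraction_Field.Fract (mpoly_to_ac p) 1 = 0"
  then have "mpoly_to_ac p = 0" by (simp add: Zero_fract_def eq_fract)
  then have "to_ac (Poly_Mapping.lookup p m) = 0" for m
    by (metis lookup_mpoly_to_ac lookup_zero)
  then show "p = 0" by (intro poly_mapping_eqI) simp
qed (simp_all add: mpoly_to_ac_add mpoly_to_ac_mult)

lemma to_ac_lift_const: "to_ac.lift (rf_const c) = rf_const (to_ac c)"
  by (simp add: rf_const_def to_ac.lift_Fract_1 mpoly_to_ac_single)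

lemma to_ac_lift_euler: "to_ac.lift (euler i h) = euler i (to_ac.lift h)"
  by (rule to_ac.lift_derivation [OF euler.derivation_axioms euler.derivation_axioms])
    (simp add: euler_Fract_1 to_ac.lift_Fract_1 mpoly_to_ac_euler)

lemma to_ac_lift_rf_bracket:
  "to_ac.lift (rf_bracket \<Omega> f g) = rf_bracket (\<chi> i j. to_ac (\<Omega> $ i $ j)) (to_ac.lift f) (to_ac.lift g)"
  by (simp add: rf_bracket_euler to_ac.lift_sum to_ac.lift_mult to_ac_lift_const to_ac_lift_euler)

section \<open>Finite-dimensional Lie algebras of rational functions\<close>

theorem theorem12:
  fixes \<Omega> :: "'k::field ^ 'n::{finite,linorder} ^ 'n::{finite,linorder}"
    and f :: "'n \<Rightarrow> ('n, 'k) ratfun"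
    and c :: "'n \<Rightarrow> 'n \<Rightarrow> 'n \<Rightarrow> 'k"
    and d :: "'n \<Rightarrow> 'n \<Rightarrow> 'k"
  assumes "skew_symmetric \<Omega>"
    and "\<And>i j. rf_bracket \<Omega> (f i) (f j) =
           (\<Sum>k\<in>UNIV. rf_const (c k i j) * f k) + rf_const (d i j)"
  shows "\<forall>i j. rf_bracket \<Omega> (f i) (f j) = 0"
proof (intro allI)
  fix i j
  let ?\<Omega> = "\<chi> i j. to_ac (\<Omega> $ i $ j)"
  have skew: "skew_symmetric ?\<Omega>"
  proof -
    have anti: "\<Omega> $ k $ l = - \<Omega> $ l $ k" and diag: "\<Omega> $ k $ k = 0" for k l
      using assms(1) unfolding skew_symmetric_def by blast+
    have "to_ac (\<Omega> $ k $ l) = - to_ac (\<Omega> $ l $ k)" for k l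
      unfolding to_ac_minus [symmetric] by (rule arg_cong [of _ _ to_ac]) (rule anti)
    moreover have "to_ac (\<Omega> $ k $ k) = 0" for k
      by (simp add: diag)
    ultimately show ?thesis
      unfolding skew_symmetric_def vec_lambda_beta by blast
  qed
  have "to_ac.lift (rf_bracket \<Omega> (f i) (f j)) = 0"
    unfolding to_ac_lift_rf_bracket
  proof (rule rf_bracket_eq_0_alg_closed [OF skew, of "\<lambda>i. to_ac.lift (f i)"])
    fix i j
    show "rf_bracket ?\<Omega> (to_ac.lift (f i)) (to_ac.lift (f j)) =
        (\<Sum>k\<in>UNIV. rf_const (to_ac (c k i j)) * to_ac.lift (f k)) + rf_const (to_ac (d i j))"
      by (simp only: to_ac_lift_rf_bracket [symmetric] assms(2) to_ac.lift_add to_ac.lift_sum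
          to_ac.lift_mult to_ac_lift_const)
  qed
  then show "rf_bracket \<Omega> (f i) (f j) = 0" by (rule to_ac.lift_eq_0)
qed

end
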